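(* Let $k\geq 4$ be an even integer and let $\beta^*\in\mathbb{R}$ with $|\beta^*|\ge k\ln 2$. Let $n$ be a sufficiently large multiple of $k/2$. If $d\ge k^2/2$, then there exists a formula $\Phi\in\Phi_{n,k,d}$ such that it is impossible to estimate $\beta^*$ from a sample $\sigma\sim\Pr_{\Phi,\beta^*}$ with high probability.
   Context: $\Phi_{n,k,d}$ denotes the set of CNF formulas on $n$ Boolean variables in which every clause contains exactly $k$ distinct variables (each possibly negated) and every variable appears (negated or not) in at most $d$ clauses. Let $\Omega_n=\{\mathsf{TRUE},\mathsf{FALSE}\}^n$ and, for $\sigma\in\Omega_n$, let $m(\sigma)$ be the number of variables set to $\mathsf{TRUE}$. For a formula $\Psi$ and $\beta\in\mathbb{R}$, $\Pr_{\Psi,\beta}[\sigma]=e^{\beta m(\sigma)}\mathbbm{1}[\sigma\models\Psi]/\sum_{\tau\in\Omega_n}e^{\beta m(\tau)}\mathbbm{1}[\tau\models\Psi]$. An estimator is a function $\hat\beta$ of the sample (and the known formula); $\beta^*$ is not identifiable by $\hat\beta$ if there is a constant $\epsilon_0>0$ with $\limsup_n|\hat\beta-\beta^*|\ge\epsilon_0$. "Impossible to estimate $\beta^*$" means $\beta^*$ is not identifiable by any estimator.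
   Formalization: Taken literally the claim fails: the constant estimator β* identifies β*. Proved instead: with formulas depending only on the sign of β*, every estimator fails at all β of that sign with |β| ≥ k ln 2, except at most one value depending on the estimator. *)

theory Defs
  imports Complex_Main "HOL-Library.FuncSet" "HOL-Library.Extended_Real"
begin

text \<open>Variables of a formula on \<open>n\<close> variables are the numbers \<open>0, \<dots>, n - 1\<close>.
  The literal \<open>(v, True)\<close> is the variable \<open>v\<close>, and \<open>(v, False)\<close> is its negation.\<close>

type_synonym literal = "nat \<times> bool"
type_synonym clause = "literal set"
type_synonym cnf = "clause set"
type_synonym assignment = "nat \<Rightarrow> bool"

text \<open>The two cardinality conditions together say that a clause has exactly \<open>k\<close> literals, and
  that these are on \<open>k\<close> distinct variables (so no clause contains a variable and its negation).\<close>

definition cnf_formulas :: "nat \<Rightarrow> nat \<Rightarrow> nat \<Rightarrow> cnf set" where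
  "cnf_formulas n k d =
     {\<Psi>. finite \<Psi> \<and>
         (\<forall>C\<in>\<Psi>. finite C \<and> fst ` C \<subseteq> {..<n} \<and> card C = k \<and> card (fst ` C) = k) \<and>
         (\<forall>v<n. card {C\<in>\<Psi>. v \<in> fst ` C} \<le> d)}"

definition assignments :: "nat \<Rightarrow> assignment set" where
  "assignments n = {..<n} \<rightarrow>\<^sub>E UNIV"

definition satisfies :: "assignment \<Rightarrow> cnf \<Rightarrow> bool" where
  "satisfies \<sigma> \<Psi> \<longleftrightarrow> (\<forall>C\<in>\<Psi>. \<exists>(v, s)\<in>C. \<sigma> v = s)"

definition num_true :: "nat \<Rightarrow> assignment \<Rightarrow> nat" where
  "num_true n \<sigma> = card {v. v < n \<and> \<sigma> v}"

definition weight :: "nat \<Rightarrow> cnf \<Rightarrow> real \<Rightarrow> assignment \<Rightarrow> real" where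
  "weight n \<Psi> \<beta> \<sigma> = exp (\<beta> * real (num_true n \<sigma>)) * of_bool (satisfies \<sigma> \<Psi>)"

definition gibbs :: "nat \<Rightarrow> cnf \<Rightarrow> real \<Rightarrow> assignment \<Rightarrow> real" where
  "gibbs n \<Psi> \<beta> \<sigma> = weight n \<Psi> \<beta> \<sigma> / (\<Sum>\<tau>\<in>assignments n. weight n \<Psi> \<beta> \<tau>)"

text \<open>For an unsatisfiable formula the normalising sum is 0, hence every event gets
  probability 0 and no event holds with high probability.\<close>

definition gibbs_prob :: "nat \<Rightarrow> cnf \<Rightarrow> real \<Rightarrow> assignment set \<Rightarrow> real" where
  "gibbs_prob n \<Psi> \<beta> A = (\<Sum>\<sigma>\<in>assignments n \<inter> A. gibbs n \<Psi> \<beta> \<sigma>)"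

text \<open>An estimator receives \<open>n\<close>, the formula and the sample.\<close>

type_synonym estimator = "nat \<Rightarrow> cnf \<Rightarrow> assignment \<Rightarrow> real"

text \<open>With high probability over the samples \<open>\<sigma> n\<close> (one for each formula \<open>\<Phi> n\<close>), the error of the
  estimator has limit superior at least \<open>\<epsilon>\<^sub>0\<close>: there are events \<open>A n\<close> whose probabilities tend
  to 1 such that this holds for all sample sequences that eventually lie in these events.
  The filter \<open>F\<close> describes how \<open>n\<close> tends to infinity.\<close>

definition not_identifiable ::
  "nat filter \<Rightarrow> (nat \<Rightarrow> cnf) \<Rightarrow> estimator \<Rightarrow> real \<Rightarrow> bool" where
  "not_identifiable F \<Phi> est \<beta> \<longleftrightarrow>
     (\<exists>\<epsilon>\<^sub>0>0. \<exists>A. ((\<lambda>n. gibbs_prob n (\<Phi> n) \<beta> (A n)) \<longlongrightarrow> 1) F \<and>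
        (\<forall>\<sigma>. (\<forall>\<^sub>F n in F. \<sigma> n \<in> A n) \<longrightarrow>
           ereal \<epsilon>\<^sub>0 \<le> Limsup F (\<lambda>n. ereal \<bar>est n (\<Phi> n) (\<sigma> n) - \<beta>\<bar>)))"

text \<open>Impossibility of estimating an unknown parameter in \<open>\<Theta>\<close>. An estimator may be
  constant, and a constant estimator identifies its own value. This is the only thing that has
  to be excepted: every estimator fails at all parameters in \<open>\<Theta>\<close>, except possibly at
  one single value \<open>c\<close>. The formulas do not depend on the parameter in \<open>\<Theta>\<close>, so that knowing
  them gives no information about it.\<close>

definition impossible_to_estimate :: "nat filter \<Rightarrow> (nat \<Rightarrow> cnf) \<Rightarrow> real set \<Rightarrow> bool" where
  "impossible_to_estimate F \<Phi> \<Theta> \<longleftrightarrow>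
     (\<forall>est. \<exists>c. \<forall>\<beta>\<in>\<Theta> - {c}. not_identifiable F \<Phi> est \<beta>)"

definition multiples_at_top :: "nat \<Rightarrow> nat filter" where
  "multiples_at_top m = inf sequentially (principal {n. m dvd n})"

end

theory Submission
  imports Defs
begin

text \<open>Arrange the variables on a cycle, and let the clauses be the cyclic windows of length \<open>k\<close>
  in which only the first literal has sign \<open>s\<close>. The constant assignment \<open>s\<close> is a solution. In
  any other solution, a variable with value \<open>\<not> s\<close> is followed by another one at distance
  less than \<open>k\<close>, so going around the cycle at least \<open>n / (k - 1)\<close> variables deviate from \<open>s\<close>. If \<open>s\<close>
  is the sign of \<open>\<beta>\<close> and \<open>\<bar>\<beta>\<bar> \<ge> k ln 2\<close>, the at most \<open>2\<^sup>n\<close> other solutions have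
  relative weight at most \<open>2\<^sup>n 2\<^bsup>-kn/(k-1)\<^esup> \<le> 2\<^bsup>-n/(k-1)\<^esup>\<close>. So the sample is
  the constant assignment with high probability, whatever \<open>\<beta>\<close> is.\<close>

text \<open>The sign \<open>(j = 0) = s\<close> is \<open>s\<close> at offset 0 and
  \<open>\<not> s\<close> elsewhere, so the clause is an implication: if variable \<open>u\<close>
  deviates from \<open>s\<close>, so does one of the next \<open>k - 1\<close> variables on the
  cycle.\<close>

definition window_clause :: "nat \<Rightarrow> bool \<Rightarrow> nat \<Rightarrow> nat \<Rightarrow> clause" where
  "window_clause k s n u = (\<lambda>j. ((u + j) mod n, (j = 0) = s)) ` {..<k}"

definition window_formula :: "nat \<Rightarrow> bool \<Rightarrow> nat \<Rightarrow> cnf" where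
  "window_formula k s n = window_clause k s n ` {..<n}"

definition const_assignment :: "bool \<Rightarrow> nat \<Rightarrow> assignment" where
  "const_assignment s n = (\<lambda>v\<in>{..<n}. s)"

definition deviations :: "bool \<Rightarrow> nat \<Rightarrow> assignment \<Rightarrow> nat set" where
  "deviations s n \<sigma> = {v. v < n \<and> \<sigma> v \<noteq> s}"

section \<open>Cyclic windows as clauses of bounded degree\<close>

lemma inj_on_add_mod:
  fixes n k u :: nat
  assumes "k \<le> n"
  shows "inj_on (\<lambda>j. (u + j) mod n) {..<k}"
proof (rule linorder_inj_onI')
  fix i j assume ij: "i \<in> {..<k}" "j \<in> {..<k}" "i < j"
  show "(u + i) mod n \<noteq> (u + j) mod n"
  proof
    assume "(u + i) mod n = (u + j) mod n"
    then have "n dvd (u + j) - (u + i)" using ij by (subst mod_eq_dvd_iff_nat[symmetric]) auto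
    then have "n dvd j - i" by simp
    then show False using ij assms by (auto dest: dvd_imp_le)
  qed
qed

lemma fst_window_clause:
  "fst ` window_clause k s n u = (\<lambda>j. (u + j) mod n) ` {..<k}"
  by (simp add: window_clause_def image_image)

text \<open>A variable lies only in the windows that start at it or at one of the
  \<open>k - 1\<close> positions before it, so its degree is at most \<open>k\<close>.\<close>

lemma window_formula_in_cnf_formulas:
  assumes "k \<le> n" "k \<le> d" "0 < k"
  shows "window_formula k s n \<in> cnf_formulas n k d"
proof -
  have n: "0 < n" using assms by simp
  have card_vars: "card (fst ` window_clause k s n u) = k" for u
    using card_image[OF inj_on_add_mod[OF assms(1), of u]] by (simp add: fst_window_clause)
  have card_clause: "card (window_clause k s n u) = k" for u
  proof (rule antisym)
    show "card (window_clause k s n u) \<le> k"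
      unfolding window_clause_def using card_image_le[of "{..<k}"] by fastforce
    show "k \<le> card (window_clause k s n u)"
      using card_image_le[of "window_clause k s n u" fst] card_vars[of u]
      by (simp add: window_clause_def)
  qed
  have degree: "card {C \<in> window_formula k s n. v \<in> fst ` C} \<le> d" if "v < n" for v
  proof -
    \<comment> \<open>The start of a window is its variable at offset \<open>j\<close> minus
      \<open>j\<close> modulo \<open>n\<close>; the summand \<open>n\<close> avoids truncated
      subtraction.\<close>
    have "{C \<in> window_formula k s n. v \<in> fst ` C}
            \<subseteq> (\<lambda>j. window_clause k s n ((v + n - j) mod n)) ` {..<k}"
    proof
      fix C assume "C \<in> {C \<in> window_formula k s n. v \<in> fst ` C}"
      then obtain u where u: "u < n" "C = window_clause k s n u" and "v \<in> fst ` C"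
        by (auto simp: window_formula_def)
      then obtain j where j: "j < k" "v = (u + j) mod n"
        unfolding fst_window_clause u(2) by blast
      have "(v + n - j) mod n = u"
      proof -
        have "(v + n - j) mod n = (v + (n - j)) mod n" using j assms by simp
        also have "\<dots> = (u + j + (n - j)) mod n" unfolding j(2) by (rule mod_add_left_eq)
        also have "u + j + (n - j) = u + n" using j assms by simp
        finally show ?thesis using u(1) by simp
      qed
      then show "C \<in> (\<lambda>j. window_clause k s n ((v + n - j) mod n)) ` {..<k}"
        using u(2) j(1) by (intro image_eqI[of _ _ j]) auto
    qed
    then have "card {C \<in> window_formula k s n. v \<in> fst ` C} \<le> card {..<k}"
      by (rule surj_card_le[rotated]) simp
    then show ?thesis using assms by simp
  qed
  show ?thesis
    unfolding cnf_formulas_def using card_vars card_clause degree n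
    by (auto simp: window_formula_def fst_window_clause window_clause_def)
qed

section \<open>Solutions and their deviations from the constant assignment\<close>

lemma satisfies_const_assignment:
  assumes "0 < k"
  shows "satisfies (const_assignment s n) (window_formula k s n)"
  unfolding satisfies_def window_formula_def window_clause_def const_assignment_def
  using assms by (auto intro!: bexI[of _ 0])

text \<open>The clause starting at \<open>u\<close> has its first literal falsified, so a later
  literal holds, and that one has sign \<open>\<not> s\<close>.\<close>

lemma next_deviation:
  assumes sat: "satisfies \<sigma> (window_formula k s n)" and u: "u \<in> deviations s n \<sigma>"
  shows "\<exists>j\<ge>1. j < k \<and> (u + j) mod n \<in> deviations s n \<sigma>"
proof -
  have "u < n" "\<sigma> u \<noteq> s" using u by (auto simp: deviations_def)
  then obtain j where j: "j < k" "\<sigma> ((u + j) mod n) = ((j = 0) = s)"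
    using sat unfolding satisfies_def window_formula_def window_clause_def by auto
  have "j \<noteq> 0" using j \<open>u < n\<close> \<open>\<sigma> u \<noteq> s\<close> by (cases "j = 0") auto
  then show ?thesis using j \<open>u < n\<close> by (intro exI[of _ j]) (auto simp: deviations_def)
qed

text \<open>A window of \<open>k - 1\<close> positions slides around the cycle. A step to the right
  loses a deviation only at the left end, and \<open>next_deviation\<close> then supplies another at
  distance at most \<open>k - 1\<close>, which is inside the shifted window.\<close>

lemma deviation_in_window:
  assumes sat: "satisfies \<sigma> (window_formula k s n)" and v: "v \<in> deviations s n \<sigma>" and "2 \<le> k"
  shows "\<exists>j<k - 1. (v + t + j) mod n \<in> deviations s n \<sigma>"
proof (induction t)
  case 0
  have "v mod n = v" using v by (simp add: deviations_def)
  then show ?case using v \<open>2 \<le> k\<close> by (intro exI[of _ 0]) auto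
next
  case (Suc t)
  then obtain j where j: "j < k - 1" "(v + t + j) mod n \<in> deviations s n \<sigma>" by blast
  obtain i where i: "1 \<le> i" "i < k" "(v + t + i) mod n \<in> deviations s n \<sigma>"
  proof (cases j)
    case 0
    with next_deviation[OF sat j(2)] that show ?thesis by (auto simp: mod_add_left_eq)
  next
    case (Suc i)
    then show ?thesis using that[of j] j by simp
  qed
  have "v + Suc t + (i - 1) = v + t + i" using i by simp
  then show ?case using i by (intro exI[of _ "i - 1"]) auto
qed

text \<open>Each variable is followed by a deviation \<open>w\<close> at some offset
  \<open>j < k - 1\<close>, so stepping back from \<open>w\<close> by \<open>j\<close> maps the
  pairs \<open>(j, w)\<close> onto all \<open>n\<close> variables.\<close>

lemma card_deviations_ge:
  assumes sat: "satisfies \<sigma> (window_formula k s n)" and ne: "deviations s n \<sigma> \<noteq> {}"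
    and "2 \<le> k" "k \<le> n"
  shows "n \<le> (k - 1) * card (deviations s n \<sigma>)"
proof -
  obtain v where v: "v \<in> deviations s n \<sigma>" using ne by blast
  have vn: "v < n" using v by (simp add: deviations_def)
  have "{..<n} \<subseteq> (\<lambda>(j, w). (w + n - j) mod n) ` ({..<k - 1} \<times> deviations s n \<sigma>)"
  proof
    fix u assume u: "u \<in> {..<n}"
    \<comment> \<open>The shift \<open>u + n - v\<close> makes the window start at \<open>u\<close>,
      up to one full turn; \<open>v < n\<close> keeps the subtraction exact.\<close>
    obtain j where j: "j < k - 1" "(v + (u + n - v) + j) mod n \<in> deviations s n \<sigma>"
      using deviation_in_window[OF sat v \<open>2 \<le> k\<close>] by blast
    define w where "w = (u + j) mod n"
    have "v + (u + n - v) + j = (u + j) + n" using vn by simp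
    then have w: "w \<in> deviations s n \<sigma>" using j(2) by (metis w_def mod_add_self2)
    have "(w + n - j) mod n = (w + (n - j)) mod n" using j assms by simp
    also have "\<dots> = (u + j + (n - j)) mod n" unfolding w_def by (rule mod_add_left_eq)
    also have "u + j + (n - j) = u + n" using j assms by simp
    finally have "(w + n - j) mod n = u" using u by simp
    then show "u \<in> (\<lambda>(j, w). (w + n - j) mod n) ` ({..<k - 1} \<times> deviations s n \<sigma>)"
      using j w by force
  qed
  then have "card {..<n} \<le> card ({..<k - 1} \<times> deviations s n \<sigma>)"
    by (rule surj_card_le[rotated]) (simp add: deviations_def)
  then show ?thesis by (simp add: card_cartesian_product)
qed

section \<open>Concentration of the Gibbs distribution\<close>

lemma const_assignment_in_assignments: "const_assignment s n \<in> assignments n"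
  by (auto simp: const_assignment_def assignments_def)

lemma deviations_empty_iff:
  assumes "\<sigma> \<in> assignments n"
  shows "deviations s n \<sigma> = {} \<longleftrightarrow> \<sigma> = const_assignment s n"
proof
  assume "deviations s n \<sigma> = {}"
  then show "\<sigma> = const_assignment s n"
    using assms unfolding deviations_def const_assignment_def assignments_def
    by (intro ext) (auto simp: PiE_def extensional_def)
qed (auto simp: deviations_def const_assignment_def)

text \<open>Each deviation costs a factor \<open>exp (- \<bar>\<beta>\<bar>)\<close>: for positive
  \<beta> it removes a true variable, for negative \<beta> it adds one.\<close>

lemma exp_num_true:
  assumes "\<beta> \<noteq> 0"
  shows "exp (\<beta> * real (num_true n \<sigma>)) =
    exp (\<beta> * real (num_true n (const_assignment (0 < \<beta>) n))) *
    exp (- \<bar>\<beta>\<bar> * real (card (deviations (0 < \<beta>) n \<sigma>)))"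
proof (cases "0 < \<beta>")
  case True
  have "num_true n \<sigma> + card (deviations True n \<sigma>)
      = card ({v. v < n \<and> \<sigma> v} \<union> {v. v < n \<and> \<not> \<sigma> v})"
    unfolding num_true_def deviations_def by (subst card_Un_disjoint) auto
  also have "{v. v < n \<and> \<sigma> v} \<union> {v. v < n \<and> \<not> \<sigma> v} = {..<n}" by auto
  finally have "real (num_true n \<sigma>) = real n - real (card (deviations True n \<sigma>))"
    by simp
  moreover have "{v. v < n \<and> const_assignment True n v} = {..<n}"
    by (auto simp: const_assignment_def)
  then have "num_true n (const_assignment True n) = n" by (simp add: num_true_def)
  ultimately show ?thesis using True by (simp add: right_diff_distrib flip: exp_add)
next
  case False
  have "{v. v < n \<and> const_assignment False n v} = {}"
    by (auto simp: const_assignment_def)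
  then have "num_true n (const_assignment False n) = 0" by (simp add: num_true_def)
  then show ?thesis using False assms by (simp add: num_true_def deviations_def)
qed

text \<open>The summand \<open>n\<close> in the exponent offsets the up to \<open>2 ^ n\<close>
  competing assignments; \<open>n / (k - 1)\<close> is the gain that survives.\<close>

lemma weight_window_formula_le:
  assumes \<beta>: "real k * ln 2 \<le> \<bar>\<beta>\<bar>" and k: "2 \<le> k" "k \<le> n"
    and \<sigma>: "\<sigma> \<in> assignments n" "\<sigma> \<noteq> const_assignment (0 < \<beta>) n"
  shows "weight n (window_formula k (0 < \<beta>) n) \<beta> \<sigma> \<le>
    exp (\<beta> * real (num_true n (const_assignment (0 < \<beta>) n))) *
    exp (- ln 2 * (real n + real n / real (k - 1)))"
proof (cases "satisfies \<sigma> (window_formula k (0 < \<beta>) n)")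
  case True
  define f where "f = real (card (deviations (0 < \<beta>) n \<sigma>))"
  have "0 < real k * ln 2" using k by simp
  then have "\<beta> \<noteq> 0" using \<beta> by auto
  have "n \<le> (k - 1) * card (deviations (0 < \<beta>) n \<sigma>)"
    using card_deviations_ge[OF True _ k] deviations_empty_iff[OF \<sigma>(1)] \<sigma>(2) by blast
  then have "real n \<le> real (k - 1) * f" unfolding f_def of_nat_mult[symmetric] of_nat_le_iff .
  then have "real n / real (k - 1) \<le> f" using k by (simp add: field_simps)
  \<comment> \<open>Since \<open>k = (k - 1) + 1\<close>, the cost factor \<open>k\<close> times the
    minimal number of deviations splits into the two summands of the exponent.\<close>
  moreover have "real k * (real n / real (k - 1)) = real n + real n / real (k - 1)"
    using k by (simp add: field_simps of_nat_diff)
  ultimately have "real n + real n / real (k - 1) \<le> real k * f"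
    by (metis mult_left_mono of_nat_0_le_iff)
  then have "ln 2 * (real n + real n / real (k - 1)) \<le> ln 2 * (real k * f)"
    by (intro mult_left_mono) auto
  also have "\<dots> \<le> \<bar>\<beta>\<bar> * f" using mult_right_mono[OF \<beta>, of f] by (simp add: f_def mult_ac)
  finally show ?thesis
    using True by (simp add: weight_def exp_num_true[OF \<open>\<beta> \<noteq> 0\<close>, of n \<sigma>] f_def)
qed (simp add: weight_def)

text \<open>All other assignments together weigh at most \<open>2 powr (- n / (k - 1))\<close> times
  as much as the constant one.\<close>

lemma gibbs_const_assignment_ge:
  assumes \<beta>: "real k * ln 2 \<le> \<bar>\<beta>\<bar>" and k: "2 \<le> k" "k \<le> n"
  shows "1 / (1 + 2 powr (- real n / real (k - 1))) \<le>
    gibbs_prob n (window_formula k (0 < \<beta>) n) \<beta> {const_assignment (0 < \<beta>) n}"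
proof -
  define c where "c = const_assignment (0 < \<beta>) n"
  define W where "W = weight n (window_formula k (0 < \<beta>) n) \<beta>"
  define r where "r = exp (- ln 2 * (real n + real n / real (k - 1)))"
  have fin: "finite (assignments n)" by (simp add: assignments_def finite_PiE)
  have card: "card (assignments n) = 2 ^ n" by (simp add: assignments_def card_PiE)
  have c: "c \<in> assignments n" by (simp add: c_def const_assignment_in_assignments)
  have Wc: "W c = exp (\<beta> * real (num_true n c))"
    using k by (simp add: W_def c_def weight_def satisfies_const_assignment)
  have "sum W (assignments n - {c}) \<le> real (card (assignments n - {c})) * (W c * r)"
    using weight_window_formula_le[OF assms]
    by (intro sum_bounded_above) (auto simp: Wc, simp add: W_def c_def r_def)
  also have "\<dots> \<le> 2 ^ n * (W c * r)"
  proof (rule mult_right_mono)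
    have "card (assignments n - {c}) \<le> 2 ^ n"
      using card_Diff1_le[of "assignments n" c] by (simp only: card)
    then show "real (card (assignments n - {c})) \<le> 2 ^ n"
      by (metis of_nat_le_iff of_nat_numeral of_nat_power)
  qed (simp add: Wc r_def)
  also have "(2 :: real) ^ n = exp (real n * ln 2)"
    by (simp add: exp_of_nat_mult)
  also have "exp (real n * ln 2) * (W c * r) = W c * (exp (real n * ln 2) * r)"
    by simp
  \<comment> \<open>The factor \<open>exp (- ln 2 * n)\<close> of \<open>r\<close> cancels the
    number of assignments.\<close>
  also have "exp (real n * ln 2) * r = 2 powr (- real n / real (k - 1))"
    unfolding r_def powr_def exp_add[symmetric] by (simp add: algebra_simps)
  finally have rest: "sum W (assignments n - {c}) \<le> W c * 2 powr (- real n / real (k - 1))" .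
  have nonneg: "0 \<le> sum W (assignments n - {c})"
    by (intro sum_nonneg) (simp add: W_def weight_def)
  have pos: "0 < W c" by (simp add: Wc)
  have "gibbs_prob n (window_formula k (0 < \<beta>) n) \<beta> {c} = W c / sum W (assignments n)"
    using c by (simp add: gibbs_prob_def gibbs_def W_def)
  also have "\<dots> = W c / (W c + sum W (assignments n - {c}))"
    by (simp add: sum.remove[OF fin c])
  also have "\<dots> \<ge> W c / (W c + W c * 2 powr (- real n / real (k - 1)))"
    using rest nonneg pos by (intro divide_left_mono mult_pos_pos add_pos_nonneg) auto
  also have "W c / (W c + W c * 2 powr (- real n / real (k - 1)))
      = 1 / (1 + 2 powr (- real n / real (k - 1)))"
    using pos by (metis mult.right_neutral distrib_left mult_divide_mult_cancel_left less_irrefl)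
  finally show ?thesis by (simp add: c_def)
qed

lemma gibbs_prob_le_1: "gibbs_prob n \<Psi> \<beta> A \<le> 1"
proof -
  define Z where "Z = sum (weight n \<Psi> \<beta>) (assignments n)"
  have fin: "finite (assignments n)" by (simp add: assignments_def finite_PiE)
  have nonneg: "0 \<le> weight n \<Psi> \<beta> \<sigma>" for \<sigma> by (simp add: weight_def)
  have "gibbs_prob n \<Psi> \<beta> A = sum (weight n \<Psi> \<beta>) (assignments n \<inter> A) / Z"
    by (simp add: gibbs_prob_def gibbs_def Z_def sum_divide_distrib)
  also have "\<dots> \<le> Z / Z"
    unfolding Z_def using fin nonneg by (intro divide_right_mono sum_mono2 sum_nonneg) auto
  \<comment> \<open>For an unsatisfiable formula, \<open>Z / Z\<close> is 0.\<close>
  also have "\<dots> \<le> 1" by (cases "Z = 0") auto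
  finally show ?thesis .
qed

lemma gibbs_const_assignment_tendsto:
  assumes "real k * ln 2 \<le> \<bar>\<beta>\<bar>" and k: "2 \<le> k"
  shows "(\<lambda>n. gibbs_prob n (window_formula k (0 < \<beta>) n) \<beta> {const_assignment (0 < \<beta>) n})
    \<longlonglongrightarrow> 1"
proof (rule tendsto_sandwich)
  \<comment> \<open>The error term is the geometric sequence \<open>q ^ n\<close>.\<close>
  define q :: real where "q = 2 powr (- 1 / real (k - 1))"
  have "q < 2 powr 0" unfolding q_def using k by (intro powr_less_mono) auto
  then have "norm q < 1" by (simp add: q_def)
  then have "(\<lambda>n. 1 / (1 + q ^ n)) \<longlonglongrightarrow> 1 / (1 + 0)"
    by (intro tendsto_intros LIMSEQ_power_zero) auto
  moreover have "q ^ n = 2 powr (- real n / real (k - 1))" for n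
    by (simp add: q_def powr_powr flip: powr_realpow)
  ultimately show "(\<lambda>n. 1 / (1 + 2 powr (- real n / real (k - 1)))) \<longlonglongrightarrow> (1 :: real)"
    by simp
  show "\<forall>\<^sub>F n in sequentially. 1 / (1 + 2 powr (- real n / real (k - 1))) \<le>
      gibbs_prob n (window_formula k (0 < \<beta>) n) \<beta> {const_assignment (0 < \<beta>) n}"
    using eventually_ge_at_top[of k] by eventually_elim (rule gibbs_const_assignment_ge[OF assms])
qed (auto simp: gibbs_prob_le_1)

section \<open>From concentration to impossibility of estimation\<close>

text \<open>The singletons serve as the events \<open>A n\<close>: samples in them eventually equal
  \<open>\<sigma>\<^sub>0 n\<close>, so the error is determined, and an error that is not eventually
  below \<open>e\<close> has limit superior at least \<open>e\<close>.\<close>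

lemma not_identifiable_if_concentrated:
  assumes conc: "((\<lambda>n. gibbs_prob n (\<Phi> n) \<beta> {\<sigma>\<^sub>0 n}) \<longlongrightarrow> 1) F"
    and not_lim: "\<not> ((\<lambda>n. est n (\<Phi> n) (\<sigma>\<^sub>0 n)) \<longlongrightarrow> \<beta>) F"
  shows "not_identifiable F \<Phi> est \<beta>"
proof -
  obtain e where e: "0 < e" "\<not> (\<forall>\<^sub>F n in F. dist (est n (\<Phi> n) (\<sigma>\<^sub>0 n)) \<beta> < e)"
    using not_lim unfolding tendsto_iff by blast
  have "ereal e \<le> Limsup F (\<lambda>n. ereal \<bar>est n (\<Phi> n) (\<sigma> n) - \<beta>\<bar>)"
    if \<sigma>: "\<forall>\<^sub>F n in F. \<sigma> n \<in> {\<sigma>\<^sub>0 n}" for \<sigma>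
  proof (rule ccontr)
    assume "\<not> ?thesis"
    then have "\<forall>\<^sub>F n in F. ereal \<bar>est n (\<Phi> n) (\<sigma> n) - \<beta>\<bar> < ereal e"
      by (intro Limsup_lessD) auto
    with \<sigma> have "\<forall>\<^sub>F n in F. dist (est n (\<Phi> n) (\<sigma>\<^sub>0 n)) \<beta> < e"
      by eventually_elim (auto simp: dist_real_def)
    with e(2) show False ..
  qed
  with e(1) conc show ?thesis
    unfolding not_identifiable_def by (intro exI[of _ e] conjI exI[of _ "\<lambda>n. {\<sigma>\<^sub>0 n}"]) auto
qed

text \<open>The samples concentrate on the same \<open>\<sigma>\<^sub>0\<close> for every parameter,
  so the estimator yields a single sequence of values, which converges to at most one
  parameter.\<close>

lemma impossible_to_estimate_if_concentrated:
  assumes "F \<noteq> bot"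
    and "\<And>\<beta>. \<beta> \<in> \<Theta> \<Longrightarrow> ((\<lambda>n. gibbs_prob n (\<Phi> n) \<beta> {\<sigma>\<^sub>0 n}) \<longlongrightarrow> 1) F"
  shows "impossible_to_estimate F \<Phi> \<Theta>"
  unfolding impossible_to_estimate_def
proof
  fix est :: estimator
  let ?x = "\<lambda>n. est n (\<Phi> n) (\<sigma>\<^sub>0 n)"
  \<comment> \<open>The exceptional value \<open>c\<close> is the limit if there is one, and
    arbitrary otherwise.\<close>
  obtain c where "(?x \<longlongrightarrow> c) F \<or> (\<forall>b. \<not> (?x \<longlongrightarrow> b) F)" by blast
  then have "\<forall>\<beta>\<in>\<Theta> - {c}. not_identifiable F \<Phi> est \<beta>"
    using assms by (auto intro!: not_identifiable_if_concentrated[of \<Phi> _ \<sigma>\<^sub>0]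
        dest: tendsto_unique[OF assms(1)])
  then show "\<exists>c. \<forall>\<beta>\<in>\<Theta> - {c}. not_identifiable F \<Phi> est \<beta>" ..
qed

text \<open>Supplies the proper filter that uniqueness of limits relies on.\<close>

lemma multiples_at_top_neq_bot:
  assumes "0 < m"
  shows "multiples_at_top m \<noteq> bot"
proof
  assume "multiples_at_top m = bot"
  then have "\<forall>\<^sub>F n in sequentially. \<not> m dvd n"
    unfolding multiples_at_top_def trivial_limit_def eventually_inf_principal by simp
  then obtain N where "\<And>n. N \<le> n \<Longrightarrow> \<not> m dvd n"
    by (auto simp: eventually_sequentially)
  from this[of "m * N"] assms show False by simp
qed

theorem theorem1p3:
  fixes k d :: nat and \<beta>star :: real
  assumes "k \<ge> 4" and "even k"
    and "\<bar>\<beta>star\<bar> \<ge> real k * ln 2"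
    and "real d \<ge> (real k)\<^sup>2 / 2"
  shows "\<exists>N. \<exists>\<Phi> :: nat \<Rightarrow> cnf.
           (\<forall>n\<ge>N. k div 2 dvd n \<longrightarrow> \<Phi> n \<in> cnf_formulas n k d) \<and>
           impossible_to_estimate (multiples_at_top (k div 2)) \<Phi>
             {\<beta>. \<bar>\<beta>\<bar> \<ge> real k * ln 2 \<and> sgn \<beta> = sgn \<beta>star}"
proof (intro exI conjI)
  \<comment> \<open>This gives \<open>k \<le> k\<^sup>2 / 2 \<le> d\<close>, which leaves room for
    the degree \<open>k\<close> of the windows.\<close>
  have "real k * 2 \<le> (real k)\<^sup>2"
    unfolding power2_eq_square using assms(1) by (intro mult_left_mono) auto
  then have "k \<le> d" using assms(4) by simp
  then show "\<forall>n\<ge>k. k div 2 dvd n \<longrightarrow> window_formula k (0 < \<beta>star) n \<in> cnf_formulas n k d"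
    using assms(1) by (auto intro: window_formula_in_cnf_formulas)
  show "impossible_to_estimate (multiples_at_top (k div 2)) (window_formula k (0 < \<beta>star))
      {\<beta>. \<bar>\<beta>\<bar> \<ge> real k * ln 2 \<and> sgn \<beta> = sgn \<beta>star}"
  proof (rule impossible_to_estimate_if_concentrated)
    show "multiples_at_top (k div 2) \<noteq> bot"
      using assms(1) by (intro multiples_at_top_neq_bot) simp
    fix \<beta> assume "\<beta> \<in> {\<beta>. \<bar>\<beta>\<bar> \<ge> real k * ln 2 \<and> sgn \<beta> = sgn \<beta>star}"
    then have \<beta>: "real k * ln 2 \<le> \<bar>\<beta>\<bar>" and "sgn \<beta> = sgn \<beta>star" by auto
    \<comment> \<open>Parameters of equal sign share both the formula and the assignment on which
      the samples concentrate.\<close>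
    then have "(0 < \<beta>) = (0 < \<beta>star)" by (metis sgn_greater)
    then show "((\<lambda>n. gibbs_prob n (window_formula k (0 < \<beta>star) n) \<beta>
        {const_assignment (0 < \<beta>star) n}) \<longlongrightarrow> 1) (multiples_at_top (k div 2))"
      using gibbs_const_assignment_tendsto[OF \<beta>] assms(1)
      by (auto simp: multiples_at_top_def intro: tendsto_mono[OF inf_le1])
  qed
qed

end
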